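(* Every four-point Ptolemaic metric has $q$-negative type for $0<q\le\log_2 3$. Equivalently, if $(X,d)$ is a four-point Ptolemaic metric space, then $(X,d^{q/2})$ embeds isometrically in Euclidean space for $0<q\le\log_2 3$.
   Context: A finite metric space $(X,d)$ is Ptolemaic if $d(x,y)d(z,w)\le d(x,z)d(y,w)+d(x,w)d(y,z)$ for all $x,y,z,w\in X$. For $q>0$, a finite metric space $(X,d)$ has $q$-negative type if $\sum_{x,y\in X}c_xc_y\,d(x,y)^q\le0$ for every choice of real numbers $(c_x)_{x\in X}$ with $\sum_{x\in X}c_x=0$. "Euclidean space" means $\mathbb R^m$ for some $m$ with its standard Euclidean distance, and $d^{q/2}$ denotes the function $(x,y)\mapsto d(x,y)^{q/2}$. *)

theory Defs
  imports "HOL-Analysis.Analysis"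
begin

definition ptolemaic :: "'a set \<Rightarrow> ('a \<Rightarrow> 'a \<Rightarrow> real) \<Rightarrow> bool" where
  "ptolemaic X d \<longleftrightarrow>
     (\<forall>x\<in>X. \<forall>y\<in>X. \<forall>z\<in>X. \<forall>w\<in>X. d x y * d z w \<le> d x z * d y w + d x w * d y z)"

text \<open>Meant for finite \<open>X\<close> and \<open>q > 0\<close>; diagonal terms vanish because \<open>0 powr q = 0\<close>.\<close>

definition negative_type :: "real \<Rightarrow> 'a set \<Rightarrow> ('a \<Rightarrow> 'a \<Rightarrow> real) \<Rightarrow> bool" where
  "negative_type q X d \<longleftrightarrow>
     (\<forall>c::'a \<Rightarrow> real. (\<Sum>x\<in>X. c x) = 0 \<longrightarrow>
        (\<Sum>x\<in>X. \<Sum>y\<in>X. c x * c y * d x y powr q) \<le> 0)"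

text \<open>The dimension \<open>m\<close> is existentially quantified, so Euclidean \<open>m\<close>-space is the set of real
  sequences vanishing from index \<open>m\<close> on rather than a type. The function \<open>\<rho>\<close> is not assumed
  to be a metric.\<close>

definition embeds_isometrically_in_Euclidean :: "'a set \<Rightarrow> ('a \<Rightarrow> 'a \<Rightarrow> real) \<Rightarrow> bool" where
  "embeds_isometrically_in_Euclidean X \<rho> \<longleftrightarrow>
     (\<exists>(m::nat) f. f ` X \<subseteq> topspace (Euclidean_space m) \<and>
        (\<forall>x\<in>X. \<forall>y\<in>X. L2_set (\<lambda>i. f x i - f y i) {..<m} = \<rho> x y))"

end

theory Submission
  imports Defs
begin

text \<open>The key is that the snowflake \<open>\<rho> = d powr (q / 2)\<close> of a metric has no angle above 120 degrees: for
  \<open>0 < q \<le> log 2 3\<close> and \<open>u, v > 0\<close>,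
  \<open>(u + v) powr q \<le> u powr q + v powr q + u powr (q / 2) * v powr (q / 2)\<close>
  (\<open>powr_add_le\<close>), which is the law of cosines compared with an angle of 120 degrees. The Ptolemaic
  inequality gives in the same way that the products of opposite values of \<open>\<rho>\<close> are the sides of a
  triangle without an angle above 120 degrees.

  From here on the exponent plays no role. Four points with distances \<open>\<rho>\<close> can be placed in Euclidean
  3-space if the three angles seen from one of them add up to at most 360 degrees, which is now
  clear, and none of them exceeds the sum of the other two. If one did, then flattening
  the figure by shortening one distance would give a plane quadrilateral, two opposite angles of
  which have a sum between 120 and 240 degrees. Bretschneider's formula for its diagonals then
  contradicts the 120-degree bound for the products of opposite distances (\<open>angle_le_sum\<close>).

  Negative type follows from the embedding by expanding squares (\<open>negative_type_if_embeds\<close>).\<close>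

section \<open>Snowflakes have no angle above 120 degrees\<close>

text \<open>The function \<open>sinh x - 2 * sinh (p * x)\<close> is convex on the half-line and vanishes at \<open>0\<close>, so once
  it is positive it stays positive.\<close>
lemma sinh_ratio_sign:
  fixes p s t :: real
  assumes p: "\<bar>p\<bar> \<le> 1" "p \<le> 3/5" and st: "0 \<le> s" "s \<le> t"
    and s: "2 * sinh (p * s) < sinh s"
  shows "2 * sinh (p * t) \<le> sinh t"
proof -
  define m where "m = (\<lambda>x::real. sinh x - 2 * sinh (p * x))"
  have "convex_on {0..} m"
  proof (rule f''_ge0_imp_convex[where f' = "\<lambda>x. cosh x - 2 * p * cosh (p*x)"
        and f'' = "\<lambda>x. sinh x - 2 * p\<^sup>2 * sinh (p*x)"])
    fix x :: real assume x: "x \<in> {0..}"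
    show "(m has_real_derivative cosh x - 2 * p * cosh (p*x)) (at x)"
      unfolding m_def by (auto intro!: derivative_eq_intros)
    show "((\<lambda>x. cosh x - 2 * p * cosh (p*x)) has_real_derivative sinh x - 2 * p\<^sup>2 * sinh (p*x)) (at x)"
      by (auto intro!: derivative_eq_intros simp: power2_eq_square)
    show "0 \<le> sinh x - 2 * p\<^sup>2 * sinh (p*x)"
    proof (cases "p \<le> 0")
      case True
      then have "sinh (p*x) \<le> 0" using x by (simp add: mult_nonpos_nonneg)
      then have "2 * p\<^sup>2 * sinh (p*x) \<le> 0" by (simp add: mult_nonneg_nonpos)
      moreover have "0 \<le> sinh x" using x by simp
      ultimately show ?thesis by linarith
    next
      case False
      have "p\<^sup>2 \<le> (3/5)\<^sup>2" using False p by (intro power_mono) auto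
      then have "2 * p\<^sup>2 \<le> 1" by (simp add: power2_eq_square)
      moreover have "sinh (p*x) \<le> sinh x"
        using p x False mult_right_mono[of p 1 x] by simp
      moreover have "0 \<le> sinh (p*x)" using False x by simp
      ultimately show ?thesis
        using mult_right_mono[of "2 * p\<^sup>2" 1 "sinh (p*x)"] by linarith
    qed
  qed (simp)
  moreover have "0 < t" using st s by (cases "s = 0") auto
  ultimately have "m ((1 - s/t) * 0 + (s/t) * t) \<le> (1 - s/t) * m 0 + (s/t) * m t"
    using st unfolding convex_on_def
    by (elim conjE ballE[of _ _ 0] ballE[of _ _ t] allE[of _ "1 - s/t"] allE[of _ "s/t"]) auto
  then have "m s \<le> (s/t) * m t" using \<open>0 < t\<close> by (simp add: m_def)
  moreover have "0 < m s" using s by (simp add: m_def)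
  ultimately have "0 < (s/t) * m t" by linarith
  then have "0 < m t"
    using st \<open>0 < t\<close> by (metis divide_nonneg_pos order_less_le_trans zero_less_mult_pos zero_less_mult_iff not_less)
  then show ?thesis by (simp add: m_def)
qed

lemma log_2_3_le: "log 2 3 \<le> (8/5::real)"
proof -
  have "5 * log 2 3 = log 2 (3^5::real)" by (subst log_nat_power) auto
  also have "\<dots> \<le> log 2 (2^8::real)" by (subst log_le_cancel_iff) auto
  also have "\<dots> = 8" by (subst log_nat_power) auto
  finally show ?thesis by simp
qed

text \<open>The inequality of \<open>powr_add_le\<close> in the variable \<open>t = (ln v - ln u) / 2\<close>, after division by
  \<open>(u * v) powr (q / 2)\<close>. The logarithm \<open>g\<close> of the quotient of the two sides satisfies
  \<open>g 0 = ln 3 - q * ln 2 \<ge> 0\<close> and is bounded below by a function tending to \<open>0\<close> at infinity. Its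
  derivative has the sign of \<open>2 * sinh ((q - 1) * t) - sinh t\<close>, which changes at most once, from
  plus to minus; so \<open>g\<close> rises from \<open>g 0\<close> and then falls, and is nonnegative throughout.\<close>
lemma cosh_power_le:
  fixes q t :: real
  assumes q: "0 < q" "q \<le> log 2 3" and t: "0 \<le> t"
  shows "(2 * cosh t) powr q \<le> 1 + 2 * cosh (q * t)"
proof -
  define g where "g = (\<lambda>t::real. ln (1 + 2 * cosh (q*t)) - q * ln (2 * cosh t))"
  define g' where "g' = (\<lambda>t::real. 2 * q * sinh (q*t) / (1 + 2 * cosh (q*t)) - q * (sinh t / cosh t))"
  have pos: "0 < 1 + 2 * cosh (q*t)" "0 < cosh t" for t by (auto intro: add_pos_pos)
  have deriv: "(g has_real_derivative g' t) (at t)" for t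
    unfolding g_def g'_def using pos[of t]
    by (auto intro!: derivative_eq_intros simp: field_simps)
  have g'_eq: "g' t = q / ((1 + 2 * cosh (q*t)) * cosh t) * (2 * sinh ((q - 1) * t) - sinh t)" for t
  proof -
    have "sinh ((q - 1) * t) = sinh (q*t) * cosh t - cosh (q*t) * sinh t"
      by (simp add: left_diff_distrib sinh_diff)
    then show ?thesis unfolding g'_def using pos[of t]
      by (simp add: divide_simps) (simp add: algebra_simps)
  qed
  have coef: "0 < q / ((1 + 2 * cosh (q*t)) * cosh t)" for t using pos[of t] q by simp
  have p: "\<bar>q - 1\<bar> \<le> 1" "q - 1 \<le> 3/5" using q log_2_3_le by auto
  have "0 \<le> g t"
    \<comment> \<open>Either the derivative is nonnegative on the whole of \<open>[0, t]\<close>, or it is nonpositive from \<open>t\<close> on.\<close>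
  proof (cases "\<exists>s. 0 \<le> s \<and> s \<le> t \<and> 2 * sinh ((q - 1) * s) < sinh s")
    case False
    have "g 0 \<le> g t"
    proof (rule DERIV_nonneg_imp_nondecreasing[OF t])
      fix x assume "0 \<le> x" "x \<le> t"
      then have "0 \<le> 2 * sinh ((q - 1) * x) - sinh x" using False by force
      then have "0 \<le> g' x" unfolding g'_eq using coef[of x]
        by (intro mult_nonneg_nonneg) (auto intro: less_imp_le)
      then show "\<exists>y. (g has_real_derivative y) (at x) \<and> 0 \<le> y" using deriv by blast
    qed
    moreover have "q * ln 2 \<le> ln 3"
      using q by (simp add: log_def field_simps)
    ultimately show ?thesis by (simp add: g_def)
  next
    case True
    then obtain s where s: "0 \<le> s" "s \<le> t" "2 * sinh ((q - 1) * s) < sinh s" by blast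
    have anti: "g y \<le> g t" if "t \<le> y" for y
    proof (rule DERIV_nonpos_imp_nonincreasing[OF that])
      fix x assume "t \<le> x" "x \<le> y"
      then have "2 * sinh ((q - 1) * x) - sinh x \<le> 0"
        using sinh_ratio_sign[OF p, of s x] s by simp
      then have "g' x \<le> 0" unfolding g'_eq using coef[of x]
        by (intro mult_nonneg_nonpos) (auto intro: less_imp_le)
      then show "\<exists>y. (g has_real_derivative y) (at x) \<and> y \<le> 0" using deriv by blast
    qed
    have low: "- q * exp (- 2 * y) \<le> g y" for y
    proof -
      have "exp (q*y) \<le> 1 + 2 * cosh (q*y)"
        using exp_gt_zero[of "- (q*y)"] unfolding cosh_field_def by argo
      then have "q*y \<le> ln (1 + 2 * cosh (q*y))" using pos[of y] by (simp add: ln_ge_iff)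
      moreover have "ln (2 * cosh y) \<le> y + exp (- 2*y)"
      proof -
        have "2 * cosh y = exp y * (1 + exp (- 2*y))"
          by (simp add: cosh_field_def algebra_simps flip: exp_add)
        also have "ln \<dots> = y + ln (1 + exp (- 2*y))"
          using add_pos_pos[of 1 "exp (- 2*y)"] by (simp add: ln_mult)
        also have "\<dots> \<le> y + exp (- 2*y)" by (simp add: ln_add_one_self_le_self)
        finally show ?thesis .
      qed
      ultimately show ?thesis
        using mult_left_mono[of "ln (2 * cosh y)" "y + exp (- 2*y)" q] q
        by (simp add: g_def algebra_simps)
    qed
    have "((\<lambda>y. - q * exp (- 2 * y)) \<longlongrightarrow> - q * 0) at_top"
      by (intro tendsto_intros filterlim_compose[OF exp_at_bot]
          filterlim_tendsto_neg_mult_at_bot[OF tendsto_const] filterlim_ident) auto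
    moreover have "\<forall>\<^sub>F y in at_top. - q * exp (- 2 * y) \<le> g t"
      using eventually_ge_at_top[of t] by eventually_elim (use anti low order_trans in blast)
    ultimately have "- q * 0 \<le> g t"
      by (rule tendsto_upperbound) simp
    then show ?thesis by simp
  qed
  then have "exp (q * ln (2 * cosh t)) \<le> exp (ln (1 + 2 * cosh (q*t)))" by (simp add: g_def)
  then show ?thesis using pos[of t] by (simp add: powr_def)
qed

text \<open>At \<open>u = v\<close> this reads \<open>2 powr q \<le> 3\<close>: it is here that the bound \<open>log 2 3\<close> is needed.\<close>
lemma powr_add_le:
  fixes u v q :: real
  assumes q: "0 < q" "q \<le> log 2 3" and "0 < u" "0 < v"
  shows "(u + v) powr q \<le> u powr q + v powr q + u powr (q/2) * v powr (q/2)"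
  using \<open>0 < u\<close> \<open>0 < v\<close>
proof (induction u v rule: linorder_wlog)
  case (sym u v)
  then show ?case by (simp add: algebra_simps)
next
  case (le u v)
  define a where "a = (ln u + ln v) / 2"
  define t where "t = (ln v - ln u) / 2"
  have "0 \<le> t" using le by (simp add: t_def)
  have u: "u = exp (a - t)" and v: "v = exp (a + t)"
    using le by (simp_all add: a_def t_def field_simps)
  have pe: "exp x powr y = exp (y * x)" for x y :: real by (simp add: powr_def)
  have "u + v = exp a * (2 * cosh t)"
    by (simp add: u v cosh_field_def exp_add exp_diff exp_minus field_simps)
  then have "(u + v) powr q = exp (q*a) * (2 * cosh t) powr q"
    by (simp add: powr_mult pe)
  also have "\<dots> \<le> exp (q*a) * (1 + 2 * cosh (q*t))"
    using cosh_power_le[OF q \<open>0 \<le> t\<close>] by simp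
  also have "\<dots> = u powr q + v powr q + u powr (q/2) * v powr (q/2)"
    by (simp add: u v pe cosh_field_def field_simps flip: exp_add)
  finally show ?case .
qed

text \<open>Applied to the distances of a triangle, this says that no angle of its snowflake exceeds 120
  degrees; applied to the three products of opposite distances, it says the same of the triangle
  with these products as sides.\<close>
lemma snowflake_le:
  fixes u v w q :: real
  assumes q: "0 < q" "q \<le> log 2 3" and "0 < u" "0 < v" "0 \<le> w" "w \<le> u + v"
  shows "(w powr (q/2))\<^sup>2 \<le> (u powr (q/2))\<^sup>2 + (v powr (q/2))\<^sup>2 + u powr (q/2) * v powr (q/2)"
proof -
  have sq: "(x powr (q/2))\<^sup>2 = x powr q" for x :: real
    by (simp add: power2_eq_square flip: powr_add)
  have "w powr q \<le> (u + v) powr q" using assms by (intro powr_mono2) auto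
  also have "\<dots> \<le> u powr q + v powr q + u powr (q/2) * v powr (q/2)"
    using assms by (intro powr_add_le)
  finally show ?thesis unfolding sq .
qed

section \<open>Plane trigonometry\<close>

text \<open>For positive \<open>a\<close>, \<open>b\<close>, \<open>c\<close>: there is a Euclidean triangle with these side lengths, and none of its
  angles exceeds 120 degrees. By the law of cosines, and as \<open>cos (2 * pi / 3) = - 1/2\<close>, the latter is
  expressed by three inequalities between the sides; these imply the triangle inequalities.\<close>
definition angles_le_120 :: "real \<Rightarrow> real \<Rightarrow> real \<Rightarrow> bool" where
  "angles_le_120 a b c \<longleftrightarrow>
     a\<^sup>2 \<le> b\<^sup>2 + c\<^sup>2 + b*c \<and> b\<^sup>2 \<le> a\<^sup>2 + c\<^sup>2 + a*c \<and> c\<^sup>2 \<le> a\<^sup>2 + b\<^sup>2 + a*b"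

lemma angle_of_triangle:
  fixes a b c :: real
  assumes "0 < a" "0 < b" "0 < c" "angles_le_120 a b c"
  obtains \<gamma> where "0 \<le> \<gamma>" "\<gamma> \<le> 2*pi/3" "c\<^sup>2 = a\<^sup>2 + b\<^sup>2 - 2*a*b*cos \<gamma>"
proof -
  define C where "C = (a\<^sup>2 + b\<^sup>2 - c\<^sup>2) / (2*a*b)"
  have C: "c\<^sup>2 = a\<^sup>2 + b\<^sup>2 - 2*a*b*C"
    using assms by (simp add: C_def)
  have "a\<^sup>2 \<le> (b + c)\<^sup>2" "b\<^sup>2 \<le> (a + c)\<^sup>2"
    using assms mult_pos_pos[of b c] mult_pos_pos[of a c]
    unfolding angles_le_120_def power2_sum by linarith+
  then have "a \<le> b + c" "b \<le> a + c"
    by (metis power2_le_imp_le add_nonneg_nonneg assms(1-3) less_imp_le)+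
  then have "\<bar>a - b\<bar> \<le> \<bar>c\<bar>" by linarith
  then have "(a - b)\<^sup>2 \<le> c\<^sup>2" by (simp add: abs_le_square_iff)
  then have "(2*a*b) * C \<le> (2*a*b) * 1"
    unfolding C power2_diff by linarith
  then have C1: "C \<le> 1" using assms by simp
  have "(2*a*b) * (-1/2) \<le> (2*a*b) * C"
    using assms C unfolding angles_le_120_def by linarith
  moreover have "0 < 2*a*b" using assms by simp
  ultimately have C2: "-1/2 \<le> C" using mult_le_cancel_left_pos by blast
  show thesis
  proof (rule that)
    show "0 \<le> arccos C" using C1 C2 by (intro arccos_lbound) auto
    have "arccos C \<le> arccos (cos (2*pi/3))"
      using C1 C2 by (intro arccos_le_arccos) (auto simp: cos_120)
    then show "arccos C \<le> 2*pi/3" by (simp add: arccos_cos)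
    show "c\<^sup>2 = a\<^sup>2 + b\<^sup>2 - 2*a*b*cos (arccos C)"
      using C C1 C2 by simp
  qed
qed

lemma cos_sin_scaled: "(r * cos t)\<^sup>2 + (r * sin t)\<^sup>2 = (r::real)\<^sup>2"
  by (simp add: power_mult_distrib sin_squared_eq algebra_simps)

text \<open>The left-hand side is the squared distance of the planar points with polar coordinates
  \<open>(a, \<alpha>)\<close> and \<open>(b, - \<beta>)\<close>.\<close>
lemma planar_distance:
  fixes a b \<alpha> \<beta> :: real
  shows "(a * cos \<alpha> - b * cos \<beta>)\<^sup>2 + (a * sin \<alpha> + b * sin \<beta>)\<^sup>2
    = a\<^sup>2 + b\<^sup>2 - 2*a*b*cos (\<alpha> + \<beta>)"
proof -
  have "(a * cos \<alpha> - b * cos \<beta>)\<^sup>2 + (a * sin \<alpha> + b * sin \<beta>)\<^sup>2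
    = ((a * cos \<alpha>)\<^sup>2 + (a * sin \<alpha>)\<^sup>2) + ((b * cos \<beta>)\<^sup>2 + (b * sin \<beta>)\<^sup>2)
      - 2*a*b*cos (\<alpha> + \<beta>)"
    unfolding cos_add power2_sum power2_diff by (simp add: algebra_simps)
  then show ?thesis unfolding cos_sin_scaled .
qed

text \<open>In a triangle with sides \<open>a\<close>, \<open>b\<close>, \<open>c\<close>, let \<open>\<alpha>\<close> and \<open>\<beta>\<close> be the angles that \<open>c\<close> forms with \<open>a\<close> and \<open>b\<close>.
  The projections of \<open>a\<close> and \<open>b\<close> to the line of \<open>c\<close> add up to \<open>c\<close>, and both sides give the same
  height over \<open>c\<close>.\<close>
lemma triangle_projections:
  fixes a b c :: real
  assumes pos: "0 < a" "0 < b" "0 < c"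
    and ang: "0 \<le> \<alpha>" "\<alpha> \<le> pi" "0 \<le> \<beta>" "\<beta> \<le> pi"
    and law: "b\<^sup>2 = a\<^sup>2 + c\<^sup>2 - 2*a*c*cos \<alpha>" "a\<^sup>2 = b\<^sup>2 + c\<^sup>2 - 2*b*c*cos \<beta>"
  shows "a * cos \<alpha> + b * cos \<beta> = c" "a * sin \<alpha> = b * sin \<beta>"
proof -
  have "(2*c) * (a * cos \<alpha> + b * cos \<beta>) = (2*c) * c"
    using law by (simp add: power2_eq_square algebra_simps)
  then show 1: "a * cos \<alpha> + b * cos \<beta> = c" using pos by simp
  have "(a * sin \<alpha>)\<^sup>2 = a\<^sup>2 - (a * cos \<alpha>)\<^sup>2"
    by (simp add: power_mult_distrib sin_squared_eq algebra_simps)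
  also have "\<dots> = b\<^sup>2 - (c - a * cos \<alpha>)\<^sup>2"
    using law(1) by (simp add: power2_eq_square algebra_simps)
  also have "c - a * cos \<alpha> = b * cos \<beta>" using 1 by simp
  also have "b\<^sup>2 - (b * cos \<beta>)\<^sup>2 = (b * sin \<beta>)\<^sup>2"
    by (simp add: power_mult_distrib sin_squared_eq algebra_simps)
  finally show "a * sin \<alpha> = b * sin \<beta>"
    by (rule power2_eq_imp_eq) (use pos ang sin_ge_zero in auto)
qed

text \<open>The third angle of the triangle, opposite to \<open>c\<close>, is at most 120 degrees.\<close>
lemma angle_sum_ge_60:
  fixes a b c :: real
  assumes pos: "0 < a" "0 < b"
    and ang: "0 \<le> \<alpha>" "0 \<le> \<beta>"
    and proj: "a * cos \<alpha> + b * cos \<beta> = c" "a * sin \<alpha> = b * sin \<beta>"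
    and c: "c\<^sup>2 \<le> a\<^sup>2 + b\<^sup>2 + a*b"
  shows "pi/3 \<le> \<alpha> + \<beta>"
proof (rule ccontr)
  assume "\<not> pi/3 \<le> \<alpha> + \<beta>"
  then have "cos (pi/3) < cos (\<alpha> + \<beta>)"
    using ang by (intro cos_monotone_0_pi) auto
  then have "1/2 < cos (\<alpha> + \<beta>)" by (simp add: cos_60)
  then have "a*b < 2*a*b*cos (\<alpha> + \<beta>)" using pos by simp
  moreover have "c\<^sup>2 = a\<^sup>2 + b\<^sup>2 + 2*a*b*cos (\<alpha> + \<beta>)"
    using planar_distance[of a \<alpha> "- b" \<beta>] proj by simp
  ultimately show False using c by simp
qed

lemma cos_le_minus_half:
  assumes "2*pi/3 \<le> x" "x \<le> 4*pi/3"
  shows "cos x \<le> - 1/2"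
proof (cases "x \<le> pi")
  case True
  then have "cos x \<le> cos (2*pi/3)" using assms by (intro cos_monotone_0_pi_le) auto
  then show ?thesis by (simp add: cos_120)
next
  case False
  then have "cos (2*pi - x) \<le> cos (2*pi/3)" using assms by (intro cos_monotone_0_pi_le) auto
  then show ?thesis by (simp add: cos_120 cos_diff)
qed

text \<open>The heart of the argument. Four points \<open>1\<close>, \<open>2\<close>, \<open>3\<close>, \<open>4\<close> have mutual distances \<open>a = |14|\<close>,
  \<open>b = |24|\<close>, \<open>h = |34|\<close>, \<open>a' = |13|\<close>, \<open>b' = |23|\<close>, \<open>c = |12|\<close>, and at \<open>4\<close> one sees the angles
  \<open>\<alpha> = 143\<close>, \<open>\<beta> = 243\<close>, \<open>\<gamma> = 142\<close>.

  Suppose \<open>\<gamma> > \<alpha> + \<beta>\<close>. Unfold the triangles \<open>143\<close> and \<open>243\<close> into a plane, on opposite sides of the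
  common edge \<open>34\<close>, and let \<open>\<alpha>'\<close>, \<open>\<beta>'\<close> be their angles at \<open>3\<close>. The squared distance \<open>e\<close> of \<open>1\<close> and \<open>2\<close>
  in the plane is smaller than \<open>c\<^sup>2\<close>. The bound on the angle opposite to \<open>c\<close> in the triangle
  \<open>132\<close> therefore gives \<open>\<alpha>' + \<beta>' < 2 * pi / 3\<close>, since \<open>\<alpha>'\<close> and
  \<open>\<beta>'\<close> are at most \<open>2 * pi / 3\<close> themselves. So the sum \<open>\<alpha> + \<beta> + \<alpha>' + \<beta>'\<close> of the angles at
  \<open>3\<close> and \<open>4\<close> is less than \<open>4 * pi / 3\<close>, and it is at least \<open>2 * pi / 3\<close> as the angles at \<open>1\<close> and
  \<open>2\<close> are at most \<open>2 * pi / 3\<close>. By Bretschneider's formula \<open>e * h\<^sup>2\<close> is then at least the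
  right-hand side of \<open>ptol\<close>, contradicting \<open>e < c\<^sup>2\<close>.\<close>
lemma angle_le_sum:
  fixes a b a' b' h c \<alpha> \<beta> \<gamma> :: real
  assumes pos: "0 < a" "0 < b" "0 < a'" "0 < b'" "0 < h"
    and ang: "0 \<le> \<alpha>" "\<alpha> \<le> 2*pi/3" "0 \<le> \<beta>" "\<beta> \<le> 2*pi/3" "\<gamma> \<le> 2*pi/3"
    and law: "a'\<^sup>2 = a\<^sup>2 + h\<^sup>2 - 2*a*h*cos \<alpha>"
             "b'\<^sup>2 = b\<^sup>2 + h\<^sup>2 - 2*b*h*cos \<beta>"
             "c\<^sup>2 = a\<^sup>2 + b\<^sup>2 - 2*a*b*cos \<gamma>"
    and wide: "angles_le_120 a' h a" "angles_le_120 b' h b" "c\<^sup>2 \<le> a'\<^sup>2 + b'\<^sup>2 + a'*b'"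
    and ptol: "(c*h)\<^sup>2 \<le> (a*b')\<^sup>2 + (b*a')\<^sup>2 + (a*b')*(b*a')"
  shows "\<gamma> \<le> \<alpha> + \<beta>"
proof (rule ccontr)
  assume "\<not> \<gamma> \<le> \<alpha> + \<beta>"
  then have gt: "\<alpha> + \<beta> < \<gamma>" by simp
  obtain \<alpha>' where \<alpha>': "0 \<le> \<alpha>'" "\<alpha>' \<le> 2*pi/3" "a\<^sup>2 = a'\<^sup>2 + h\<^sup>2 - 2*a'*h*cos \<alpha>'"
    by (rule angle_of_triangle[OF pos(3) pos(5) pos(1) wide(1)])
  obtain \<beta>' where \<beta>': "0 \<le> \<beta>'" "\<beta>' \<le> 2*pi/3" "b\<^sup>2 = b'\<^sup>2 + h\<^sup>2 - 2*b'*h*cos \<beta>'"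
    by (rule angle_of_triangle[OF pos(4) pos(5) pos(2) wide(2)])
  have le_pi: "\<alpha> \<le> pi" "\<beta> \<le> pi" "\<alpha>' \<le> pi" "\<beta>' \<le> pi"
    using ang(2,4) \<alpha>'(2) \<beta>'(2) pi_gt_zero by linarith+
  note A = triangle_projections[OF pos(1,3,5) ang(1) le_pi(1) \<alpha>'(1) le_pi(3) law(1) \<alpha>'(3)]
  note B = triangle_projections[OF pos(2,4,5) ang(3) le_pi(2) \<beta>'(1) le_pi(4) law(2) \<beta>'(3)]
  define e where "e = a\<^sup>2 + b\<^sup>2 - 2*a*b*cos (\<alpha> + \<beta>)"
  have "cos \<gamma> < cos (\<alpha> + \<beta>)"
    using gt ang by (intro cos_monotone_0_pi) auto
  then have e_less: "e < c\<^sup>2" using law(3) pos by (simp add: e_def)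
  have e1: "e = (a * cos \<alpha> - b * cos \<beta>)\<^sup>2 + (a * sin \<alpha> + b * sin \<beta>)\<^sup>2"
    unfolding planar_distance e_def ..
  also have "a * cos \<alpha> - b * cos \<beta> = - (a' * cos \<alpha>' - b' * cos \<beta>')" using A B by linarith
  also have "a * sin \<alpha> + b * sin \<beta> = a' * sin \<alpha>' + b' * sin \<beta>'" using A B by linarith
  finally have e2: "e = a'\<^sup>2 + b'\<^sup>2 - 2*a'*b'*cos (\<alpha>' + \<beta>')"
    unfolding power2_minus planar_distance .
  have "(2*a'*b') * (-1/2) < (2*a'*b') * cos (\<alpha>' + \<beta>')"
    using e2 e_less wide(3) by linarith
  moreover have "0 < 2*a'*b'" using pos by simp
  ultimately have "- 1/2 < cos (\<alpha>' + \<beta>')" using mult_less_cancel_left_pos by blast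
  then have 1: "\<alpha>' + \<beta>' < 2*pi/3"
    using cos_le_minus_half[of "\<alpha>' + \<beta>'"] \<alpha>' \<beta>' by argo
  have "h\<^sup>2 \<le> a\<^sup>2 + a'\<^sup>2 + a*a'" "h\<^sup>2 \<le> b\<^sup>2 + b'\<^sup>2 + b*b'"
    using wide(1,2) unfolding angles_le_120_def by (simp_all add: mult.commute add.commute)
  then have "pi/3 \<le> \<alpha> + \<alpha>'" "pi/3 \<le> \<beta> + \<beta>'"
    using angle_sum_ge_60[OF pos(1,3) ang(1) \<alpha>'(1) A] angle_sum_ge_60[OF pos(2,4) ang(3) \<beta>'(1) B]
    by blast+
  then have "cos ((\<alpha> + \<beta>') + (\<beta> + \<alpha>')) \<le> - 1/2"
    using 1 gt ang by (intro cos_le_minus_half) argo+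
  \<comment> \<open>Bretschneider's formula. With \<open>3\<close> and \<open>4\<close> at \<open>h\<close> and \<open>0\<close> in the complex plane and \<open>1\<close> and \<open>2\<close> at \<open>z\<close>
    and \<open>w\<close>, the left-hand side is the squared modulus of \<open>h * (z - w) = z * (h - w) - w * (h - z)\<close>. The two terms on the
    right are \<open>P + \<i> * Q\<close> and \<open>R - \<i> * S\<close>.\<close>
  moreover have "e * h\<^sup>2 = (a*b')\<^sup>2 + (b*a')\<^sup>2 - 2 * (a*b'*(b*a')) * cos ((\<alpha> + \<beta>') + (\<beta> + \<alpha>'))"
  proof -
    define P Q R S where "P = (a*b') * cos (\<alpha> + \<beta>')" and "Q = (a*b') * sin (\<alpha> + \<beta>')"
      and "R = (b*a') * cos (\<beta> + \<alpha>')" and "S = (b*a') * sin (\<beta> + \<alpha>')"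
    note PQRS = P_def Q_def R_def S_def
    have C: "a' * cos \<alpha>' = h - a * cos \<alpha>" "b' * cos \<beta>' = h - b * cos \<beta>"
      using A B by linarith+
    have "P = (a * cos \<alpha>) * (b' * cos \<beta>') - (a * sin \<alpha>) * (b' * sin \<beta>')"
         "R = (b * cos \<beta>) * (a' * cos \<alpha>') - (b * sin \<beta>) * (a' * sin \<alpha>')"
      by (simp_all add: PQRS cos_add algebra_simps)
    then have PR: "P - R = h * (a * cos \<alpha> - b * cos \<beta>)"
      unfolding C A(2)[symmetric] B(2)[symmetric] by (simp add: algebra_simps)
    have "Q = (a * sin \<alpha>) * (b' * cos \<beta>') + (a * cos \<alpha>) * (b' * sin \<beta>')"
         "S = (b * sin \<beta>) * (a' * cos \<alpha>') + (b * cos \<beta>) * (a' * sin \<alpha>')"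
      by (simp_all add: PQRS sin_add algebra_simps)
    then have QS: "Q + S = h * (a * sin \<alpha> + b * sin \<beta>)"
      unfolding C A(2)[symmetric] B(2)[symmetric] by (simp add: algebra_simps)
    have "e * h\<^sup>2 = (P - R)\<^sup>2 + (Q + S)\<^sup>2"
      unfolding e1 PR QS by (simp add: power2_eq_square algebra_simps)
    also have "\<dots> = (P\<^sup>2 + Q\<^sup>2) + (R\<^sup>2 + S\<^sup>2) - 2 * (P * R - Q * S)"
      by (simp add: power2_eq_square algebra_simps)
    also have "P\<^sup>2 + Q\<^sup>2 = (a*b')\<^sup>2"
      unfolding PQRS by (rule cos_sin_scaled)
    also have "R\<^sup>2 + S\<^sup>2 = (b*a')\<^sup>2"
      unfolding PQRS by (rule cos_sin_scaled)
    also have "P * R - Q * S = (a*b'*(b*a')) * cos ((\<alpha> + \<beta>') + (\<beta> + \<alpha>'))"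
      unfolding cos_add[of "\<alpha> + \<beta>'"] by (simp add: PQRS algebra_simps)
    finally show ?thesis by (simp only: mult.assoc)
  qed
  moreover have "0 < a*b'*(b*a')" using pos by simp
  ultimately have "(a*b')\<^sup>2 + (b*a')\<^sup>2 + (a*b')*(b*a') \<le> e * h\<^sup>2"
    using mult_left_mono[of "cos ((\<alpha> + \<beta>') + (\<beta> + \<alpha>'))" "-1/2" "2 * (a*b'*(b*a'))"] by simp
  moreover have "e * h\<^sup>2 < (c*h)\<^sup>2" using e_less pos by (simp add: power_mult_distrib)
  ultimately show False using ptol by simp
qed

section \<open>Embedding four points in space\<close>

text \<open>Three angles that satisfy the triangle inequalities and add up to at most a full turn are the
  mutual angles of three unit vectors in space. The conclusion says that their Gram matrix has
  nonnegative determinant.\<close>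
lemma cos_gram_bound:
  fixes \<alpha> \<beta> \<gamma> :: real
  assumes "0 \<le> \<alpha>" "\<alpha> \<le> pi" "0 \<le> \<beta>" "\<beta> \<le> pi" "0 \<le> \<gamma>" "\<gamma> \<le> pi"
    and "\<alpha> \<le> \<beta> + \<gamma>" "\<beta> \<le> \<alpha> + \<gamma>" "\<gamma> \<le> \<alpha> + \<beta>" "\<alpha> + \<beta> + \<gamma> \<le> 2*pi"
  shows "\<bar>cos \<gamma> - cos \<alpha> * cos \<beta>\<bar> \<le> sin \<alpha> * sin \<beta>"
proof -
  have "cos \<gamma> \<le> cos (\<alpha> - \<beta>)"
  proof -
    have "cos \<gamma> \<le> cos \<bar>\<alpha> - \<beta>\<bar>" by (rule cos_monotone_0_pi_le) (use assms in auto)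
    then show ?thesis by simp
  qed
  moreover have "cos (\<alpha> + \<beta>) \<le> cos \<gamma>"
  proof (cases "\<alpha> + \<beta> \<le> pi")
    case True
    then show ?thesis by (intro cos_monotone_0_pi_le) (use assms in auto)
  next
    case False
    have "cos (2*pi - (\<alpha> + \<beta>)) \<le> cos \<gamma>"
      by (rule cos_monotone_0_pi_le) (use assms False in auto)
    then show ?thesis by (simp add: cos_diff)
  qed
  ultimately show ?thesis by (simp add: cos_add cos_diff abs_le_iff)
qed

text \<open>The unit vectors are \<open>(1, 0, 0)\<close>, \<open>(cos \<alpha>, sin \<alpha>, 0)\<close> and \<open>(cos \<beta>, k, l)\<close>.\<close>
lemma spatial_triple:
  fixes \<alpha> \<beta> \<gamma> :: real
  assumes "\<bar>cos \<gamma> - cos \<alpha> * cos \<beta>\<bar> \<le> sin \<alpha> * sin \<beta>"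
  obtains k l where "k\<^sup>2 + l\<^sup>2 = (sin \<beta>)\<^sup>2" "cos \<alpha> * cos \<beta> + sin \<alpha> * k = cos \<gamma>"
proof -
  \<comment> \<open>If \<open>sin \<alpha> = 0\<close>, then the hypothesis makes the numerator vanish as well, and \<open>k = 0\<close>.\<close>
  define k where "k = (cos \<gamma> - cos \<alpha> * cos \<beta>) / sin \<alpha>"
  have "sin \<alpha> * k = cos \<gamma> - cos \<alpha> * cos \<beta>"
    using assms by (cases "sin \<alpha> = 0") (auto simp: k_def)
  moreover have "k\<^sup>2 \<le> (sin \<beta>)\<^sup>2"
  proof (cases "sin \<alpha> = 0")
    case False
    have "\<bar>k\<bar> * \<bar>sin \<alpha>\<bar> = \<bar>cos \<gamma> - cos \<alpha> * cos \<beta>\<bar>"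
      using False by (simp add: k_def)
    also have "\<dots> \<le> \<bar>sin \<beta>\<bar> * \<bar>sin \<alpha>\<bar>"
      using assms by (metis abs_ge_self abs_mult mult.commute order_trans)
    finally have "\<bar>k\<bar> \<le> \<bar>sin \<beta>\<bar>" using False by simp
    then show ?thesis by (simp add: abs_le_square_iff)
  qed (simp add: k_def)
  ultimately show ?thesis
    using that[of k "sqrt ((sin \<beta>)\<^sup>2 - k\<^sup>2)"] by simp
qed

text \<open>One point \<open>p\<close> is sent to the origin. The angles at \<open>p\<close> are at most 120 degrees, so they add up to
  at most a full turn, and \<open>angle_le_sum\<close> gives the triangle inequalities between them; so the other
  three points can be placed along three spatial directions with these mutual angles.\<close>
lemma four_points_embed:
  fixes \<rho> :: "'a \<Rightarrow> 'a \<Rightarrow> real"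
  assumes card: "card X = 4"
    and sym: "\<And>x y. x \<in> X \<Longrightarrow> y \<in> X \<Longrightarrow> \<rho> x y = \<rho> y x"
    and refl: "\<And>x. x \<in> X \<Longrightarrow> \<rho> x x = 0"
    and pos: "\<And>x y. x \<in> X \<Longrightarrow> y \<in> X \<Longrightarrow> x \<noteq> y \<Longrightarrow> 0 < \<rho> x y"
    and triangle: "\<And>x y z. x \<in> X \<Longrightarrow> y \<in> X \<Longrightarrow> z \<in> X \<Longrightarrow> distinct [x, y, z] \<Longrightarrow>
      (\<rho> x y)\<^sup>2 \<le> (\<rho> x z)\<^sup>2 + (\<rho> y z)\<^sup>2 + \<rho> x z * \<rho> y z"
    and ptolemy: "\<And>x y z w. x \<in> X \<Longrightarrow> y \<in> X \<Longrightarrow> z \<in> X \<Longrightarrow> w \<in> X \<Longrightarrow> distinct [x, y, z, w] \<Longrightarrow>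
      (\<rho> x y * \<rho> z w)\<^sup>2 \<le> (\<rho> x w * \<rho> y z)\<^sup>2 + (\<rho> y w * \<rho> x z)\<^sup>2 + (\<rho> x w * \<rho> y z) * (\<rho> y w * \<rho> x z)"
  shows "embeds_isometrically_in_Euclidean X \<rho>"
proof -
  obtain p x y z where X: "X = {p, x, y, z}" and dist: "distinct [p, x, y, z]"
    using card by (auto simp: card_Suc_eq numeral_eq_Suc)
  have wide: "angles_le_120 (\<rho> u w) (\<rho> v w) (\<rho> u v)"
    if "u \<in> X" "v \<in> X" "w \<in> X" "distinct [u, v, w]" for u v w
    using triangle[of u v w] triangle[of u w v] triangle[of v w u] that
    unfolding angles_le_120_def by (auto simp: sym algebra_simps)
  have ang: "\<exists>\<theta>. 0 \<le> \<theta> \<and> \<theta> \<le> 2*pi/3 \<and>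
      (\<rho> u v)\<^sup>2 = (\<rho> u p)\<^sup>2 + (\<rho> v p)\<^sup>2 - 2 * \<rho> u p * \<rho> v p * cos \<theta>"
    if "u \<in> X" "v \<in> X" "distinct [u, v, p]" for u v
  proof -
    have "p \<in> X" using X by simp
    then have "0 < \<rho> u p" "0 < \<rho> v p" "0 < \<rho> u v" "angles_le_120 (\<rho> u p) (\<rho> v p) (\<rho> u v)"
      using that by (auto intro: pos wide)
    then show ?thesis using angle_of_triangle by blast
  qed
  have le: "\<gamma> \<le> \<alpha> + \<beta>"
    if uvw: "u \<in> X" "v \<in> X" "w \<in> X" "distinct [p, u, v, w]"
      and "0 \<le> \<alpha>" "\<alpha> \<le> 2*pi/3" "0 \<le> \<beta>" "\<beta> \<le> 2*pi/3" "\<gamma> \<le> 2*pi/3"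
      and "(\<rho> u w)\<^sup>2 = (\<rho> u p)\<^sup>2 + (\<rho> w p)\<^sup>2 - 2 * \<rho> u p * \<rho> w p * cos \<alpha>"
      and "(\<rho> v w)\<^sup>2 = (\<rho> v p)\<^sup>2 + (\<rho> w p)\<^sup>2 - 2 * \<rho> v p * \<rho> w p * cos \<beta>"
      and "(\<rho> u v)\<^sup>2 = (\<rho> u p)\<^sup>2 + (\<rho> v p)\<^sup>2 - 2 * \<rho> u p * \<rho> v p * cos \<gamma>"
    for u v w \<alpha> \<beta> \<gamma>
  proof (rule angle_le_sum)
    have o: "p \<in> X" using X by simp
    show "0 < \<rho> u p" "0 < \<rho> v p" "0 < \<rho> u w" "0 < \<rho> v w" "0 < \<rho> w p"
      using pos uvw o by auto
    show "angles_le_120 (\<rho> u w) (\<rho> w p) (\<rho> u p)" "angles_le_120 (\<rho> v w) (\<rho> w p) (\<rho> v p)"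
      using wide[of u p w] wide[of v p w] uvw o unfolding sym[OF uvw(3) o] by auto
    show "(\<rho> u v)\<^sup>2 \<le> (\<rho> u w)\<^sup>2 + (\<rho> v w)\<^sup>2 + \<rho> u w * \<rho> v w"
      using triangle uvw by auto
    show "(\<rho> u v * \<rho> w p)\<^sup>2 \<le> (\<rho> u p * \<rho> v w)\<^sup>2 + (\<rho> v p * \<rho> u w)\<^sup>2 + \<rho> u p * \<rho> v w * (\<rho> v p * \<rho> u w)"
      using ptolemy[of u v w p] uvw o by auto
  qed (use that in auto)
  define a b c where "a = \<rho> x p" and "b = \<rho> y p" and "c = \<rho> z p"
  obtain \<alpha> where \<alpha>: "0 \<le> \<alpha>" "\<alpha> \<le> 2*pi/3" "(\<rho> x y)\<^sup>2 = a\<^sup>2 + b\<^sup>2 - 2 * a * b * cos \<alpha>"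
    using ang[of x y] X dist unfolding a_def b_def by auto
  obtain \<beta> where \<beta>: "0 \<le> \<beta>" "\<beta> \<le> 2*pi/3" "(\<rho> x z)\<^sup>2 = a\<^sup>2 + c\<^sup>2 - 2 * a * c * cos \<beta>"
    using ang[of x z] X dist unfolding a_def c_def by auto
  obtain \<gamma> where \<gamma>: "0 \<le> \<gamma>" "\<gamma> \<le> 2*pi/3" "(\<rho> y z)\<^sup>2 = b\<^sup>2 + c\<^sup>2 - 2 * b * c * cos \<gamma>"
    using ang[of y z] X dist unfolding b_def c_def by auto
  have mem: "p \<in> X" "x \<in> X" "y \<in> X" "z \<in> X" using X by auto
  have law_flip: "(\<rho> y x)\<^sup>2 = b\<^sup>2 + a\<^sup>2 - 2 * b * a * cos \<alpha>" "(\<rho> z x)\<^sup>2 = c\<^sup>2 + a\<^sup>2 - 2 * c * a * cos \<beta>"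
    "(\<rho> z y)\<^sup>2 = c\<^sup>2 + b\<^sup>2 - 2 * c * b * cos \<gamma>"
    unfolding sym[OF mem(3,2)] sym[OF mem(4,2)] sym[OF mem(4,3)] \<alpha>(3) \<beta>(3) \<gamma>(3)
    by simp_all
  have "\<alpha> \<le> \<beta> + \<gamma>"
    by (rule le[OF mem(2,3,4) _ \<beta>(1,2) \<gamma>(1,2) \<alpha>(2) \<beta>(3)[unfolded a_def c_def]
          \<gamma>(3)[unfolded b_def c_def] \<alpha>(3)[unfolded a_def b_def]]) (use dist in auto)
  moreover have "\<beta> \<le> \<alpha> + \<gamma>"
    by (rule le[OF mem(2,4,3) _ \<alpha>(1,2) \<gamma>(1,2) \<beta>(2) \<alpha>(3)[unfolded a_def b_def]
          law_flip(3)[unfolded b_def c_def] \<beta>(3)[unfolded a_def c_def]]) (use dist in auto)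
  moreover have "\<gamma> \<le> \<alpha> + \<beta>"
    by (rule le[OF mem(3,4,2) _ \<alpha>(1,2) \<beta>(1,2) \<gamma>(2) law_flip(1)[unfolded a_def b_def]
          law_flip(2)[unfolded a_def c_def] \<gamma>(3)[unfolded b_def c_def]]) (use dist in auto)
  ultimately have "\<bar>cos \<gamma> - cos \<alpha> * cos \<beta>\<bar> \<le> sin \<alpha> * sin \<beta>"
    using \<alpha> \<beta> \<gamma> by (intro cos_gram_bound) argo+
  then obtain k l where kl: "k\<^sup>2 + l\<^sup>2 = (sin \<beta>)\<^sup>2" "cos \<alpha> * cos \<beta> + sin \<alpha> * k = cos \<gamma>"
    using spatial_triple by blast
  define f :: "'a \<Rightarrow> nat \<Rightarrow> real" where "f = (\<lambda>u i. if u = x then (if i = 0 then a else 0)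
    else if u = y then (if i = 0 then b * cos \<alpha> else if i = 1 then b * sin \<alpha> else 0)
    else if u = z then (if i = 0 then c * cos \<beta> else if i = 1 then c * k else if i = 2 then c * l else 0)
    else 0)"
  have ne: "p \<noteq> x" "p \<noteq> y" "p \<noteq> z" "y \<noteq> x" "z \<noteq> x" "z \<noteq> y"
    using dist by auto
  \<comment> \<open>the squared Euclidean distance of the images\<close>
  define S where "S = (\<lambda>u v. (f u 0 - f v 0)\<^sup>2 + (f u 1 - f v 1)\<^sup>2 + (f u 2 - f v 2)\<^sup>2)"
  have S_sym: "S u v = S v u" for u v by (simp add: S_def power2_commute)
  have xo: "S x p = (\<rho> x p)\<^sup>2" using ne by (simp add: S_def f_def a_def)
  have unit_\<beta>: "(c * cos \<beta>)\<^sup>2 + (c * k)\<^sup>2 + (c * l)\<^sup>2 = c\<^sup>2"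
  proof -
    have "(c * cos \<beta>)\<^sup>2 + (c * k)\<^sup>2 + (c * l)\<^sup>2 = c\<^sup>2 * ((cos \<beta>)\<^sup>2 + (k\<^sup>2 + l\<^sup>2))"
      by (simp add: power_mult_distrib algebra_simps)
    then show ?thesis by (simp add: kl)
  qed
  have unit_\<alpha>: "(b * cos \<alpha>)\<^sup>2 + (b * sin \<alpha>)\<^sup>2 = b\<^sup>2"
    by (rule cos_sin_scaled)
  have yo: "S y p = (\<rho> y p)\<^sup>2" using ne unit_\<alpha> by (simp add: S_def f_def b_def)
  have zo: "S z p = (\<rho> z p)\<^sup>2" using ne unit_\<beta> by (simp add: S_def f_def c_def)
  have xy: "S x y = (\<rho> x y)\<^sup>2"
    using ne unit_\<alpha> by (simp add: S_def f_def \<alpha> power2_diff)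
  have xz: "S x z = (\<rho> x z)\<^sup>2"
    using ne unit_\<beta> by (simp add: S_def f_def \<beta> power2_diff)
  have "S y z = b\<^sup>2 + c\<^sup>2 - 2 * b * c * (cos \<alpha> * cos \<beta> + sin \<alpha> * k)"
    using ne unit_\<alpha> unit_\<beta> by (simp add: S_def f_def power2_diff algebra_simps)
  then have yz: "S y z = (\<rho> y z)\<^sup>2" by (simp add: kl \<gamma>)
  have S: "S u v = (\<rho> u v)\<^sup>2" if "u \<in> X" "v \<in> X" for u v
  proof (cases "u = v")
    case True
    then show ?thesis using that by (simp add: refl) (simp add: S_def)
  next
    case False
    have flip: "S v u = (\<rho> v u)\<^sup>2" if "S u v = (\<rho> u v)\<^sup>2" "u \<in> X" "v \<in> X" for u v
      using that S_sym[of u v] sym[of u v] by simp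
    show ?thesis
      using that False xo yo zo xy xz yz xo[THEN flip] yo[THEN flip] zo[THEN flip]
        xy[THEN flip] xz[THEN flip] yz[THEN flip] mem X by fast
  qed
  show ?thesis
    unfolding embeds_isometrically_in_Euclidean_def
  proof (intro exI conjI ballI)
    show "f ` X \<subseteq> topspace (Euclidean_space 3)"
      by (auto simp: f_def topspace_Euclidean_space)
    fix u v assume uv: "u \<in> X" "v \<in> X"
    have "0 \<le> \<rho> u v" using pos[OF uv] refl[OF uv(1)] by (cases "u = v") auto
    moreover have "(\<Sum>i<3. (f u i - f v i)\<^sup>2) = S u v"
      by (simp add: S_def numeral_3_eq_3 numeral_2_eq_2)
    ultimately show "L2_set (\<lambda>i. f u i - f v i) {..<3} = \<rho> u v"
      using S[OF uv] by (simp add: L2_set_def)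
  qed
qed

section \<open>Negative type of Euclidean distances\<close>

text \<open>If \<open>\<Sum>x\<in>X. c x = 0\<close>, then expanding the squares turns \<open>\<Sum>x\<in>X. \<Sum>y\<in>X. c x * c y * |f x - f y|\<^sup>2\<close> into
  \<open>- 2 * |\<Sum>x\<in>X. c x * f x|\<^sup>2\<close>.\<close>
lemma negative_type_if_embeds:
  assumes "embeds_isometrically_in_Euclidean X (\<lambda>x y. d x y powr (q / 2))"
  shows "negative_type q X d"
  unfolding negative_type_def
proof (intro allI impI)
  fix c :: "'a \<Rightarrow> real" assume c: "(\<Sum>x\<in>X. c x) = 0"
  obtain m f where f: "\<And>x y. x \<in> X \<Longrightarrow> y \<in> X \<Longrightarrow> L2_set (\<lambda>i. f x i - f y i) {..<m::nat} = d x y powr (q / 2)"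
    using assms unfolding embeds_isometrically_in_Euclidean_def by blast
  have D: "d x y powr q = (\<Sum>i<m. (f x i - f y i)\<^sup>2)" if "x \<in> X" "y \<in> X" for x y
  proof -
    have "d x y powr q = (d x y powr (q/2))\<^sup>2" by (simp add: power2_eq_square flip: powr_add)
    also have "\<dots> = (\<Sum>i<m. (f x i - f y i)\<^sup>2)"
      using f[OF that, symmetric] by (simp add: L2_set_def sum_nonneg)
    finally show ?thesis .
  qed
  have "(\<Sum>x\<in>X. \<Sum>y\<in>X. c x * c y * d x y powr q)
      = (\<Sum>x\<in>X. \<Sum>y\<in>X. \<Sum>i<m. c x * c y * (f x i - f y i)\<^sup>2)"
    by (simp add: D sum_distrib_left)
  also have "\<dots> = (\<Sum>i<m. \<Sum>x\<in>X. \<Sum>y\<in>X. c x * c y * (f x i - f y i)\<^sup>2)"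
    by (subst sum.swap[of _ "{..<m}"], intro sum.cong refl sum.swap)
  also have "\<dots> = (\<Sum>i<m. - 2 * (\<Sum>x\<in>X. c x * f x i)\<^sup>2)"
  proof (rule sum.cong[OF refl])
    fix i
    have "(\<Sum>x\<in>X. \<Sum>y\<in>X. c x * c y * (f x i - f y i)\<^sup>2)
        = (\<Sum>x\<in>X. \<Sum>y\<in>X. (c x * (f x i)\<^sup>2) * c y + c x * (c y * (f y i)\<^sup>2)
                           - 2 * ((c x * f x i) * (c y * f y i)))"
      by (intro sum.cong refl) (simp add: power2_eq_square algebra_simps)
    also have "\<dots> = (\<Sum>x\<in>X. c x * (f x i)\<^sup>2) * (\<Sum>y\<in>X. c y) + (\<Sum>x\<in>X. c x) * (\<Sum>y\<in>X. c y * (f y i)\<^sup>2)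
                   - 2 * ((\<Sum>x\<in>X. c x * f x i) * (\<Sum>y\<in>X. c y * f y i))"
      unfolding sum_product by (simp add: sum.distrib sum_subtractf sum_distrib_left)
    finally show "(\<Sum>x\<in>X. \<Sum>y\<in>X. c x * c y * (f x i - f y i)\<^sup>2) = - 2 * (\<Sum>x\<in>X. c x * f x i)\<^sup>2"
      by (simp add: c power2_eq_square)
  qed
  also have "\<dots> \<le> 0" by (intro sum_nonpos) simp
  finally show "(\<Sum>x\<in>X. \<Sum>y\<in>X. c x * c y * d x y powr q) \<le> 0" .
qed

section \<open>Four-point Ptolemaic metrics\<close>

theorem theorem7p16:
  fixes X :: "'a set" and d :: "'a \<Rightarrow> 'a \<Rightarrow> real" and q :: real
  assumes "Metric_space X d"
    and "card X = 4"
    and "ptolemaic X d"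
    and "0 < q" and "q \<le> log 2 3"
  shows "negative_type q X d \<and>
    embeds_isometrically_in_Euclidean X (\<lambda>x y. d x y powr (q / 2))"
proof -
  interpret Metric_space X d by fact
  have pos: "0 < d x y" if "x \<in> X" "y \<in> X" "x \<noteq> y" for x y
    using that by simp
  have "embeds_isometrically_in_Euclidean X (\<lambda>x y. d x y powr (q / 2))"
  proof (rule four_points_embed)
    fix x y z assume xyz: "x \<in> X" "y \<in> X" "z \<in> X" "distinct [x, y, z]"
    have "d x y \<le> d x z + d y z"
      using triangle[of x z y] xyz by (simp add: commute)
    then show "(d x y powr (q / 2))\<^sup>2
      \<le> (d x z powr (q / 2))\<^sup>2 + (d y z powr (q / 2))\<^sup>2 + d x z powr (q / 2) * d y z powr (q / 2)"
      using assms(4,5) xyz by (intro snowflake_le) auto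
  next
    fix x y z w assume xyzw: "x \<in> X" "y \<in> X" "z \<in> X" "w \<in> X" "distinct [x, y, z, w]"
    have "d x y * d z w \<le> d x z * d y w + d x w * d y z"
      using assms(3) xyzw unfolding ptolemaic_def by blast
    then have "((d x y * d z w) powr (q / 2))\<^sup>2
      \<le> ((d x w * d y z) powr (q / 2))\<^sup>2 + ((d y w * d x z) powr (q / 2))\<^sup>2
        + (d x w * d y z) powr (q / 2) * (d y w * d x z) powr (q / 2)"
      using assms(4,5) xyzw by (intro snowflake_le) (auto simp: algebra_simps)
    then show "(d x y powr (q / 2) * d z w powr (q / 2))\<^sup>2
      \<le> (d x w powr (q / 2) * d y z powr (q / 2))\<^sup>2 + (d y w powr (q / 2) * d x z powr (q / 2))\<^sup>2
        + d x w powr (q / 2) * d y z powr (q / 2) * (d y w powr (q / 2) * d x z powr (q / 2))"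
      by (simp add: powr_mult)
  qed (use assms(2) commute pos in auto)
  then show ?thesis using negative_type_if_embeds by blast
qed

end
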